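(* Let $n\ge 3$ be odd with $3\nmid n$. Then every cardioidal starter of order $n$ is skew.
   Context: A starter in $\mathbb{Z}_n$ ($n$ odd) is a partition of $\mathbb{Z}_n\setminus\{0\}$ into $(n-1)/2$ pairs $\{s_i,t_i\}$ such that the elements $\pm(s_i-t_i)$ are exactly the non-zero elements of $\mathbb{Z}_n$; it is strong if the sums $s_i+t_i$ are non-zero and pairwise distinct, and skew if it is strong and the elements $\pm(s_i+t_i)$, $i=1,\dots,(n-1)/2$, are exactly the non-zero elements of $\mathbb{Z}_n$. A starter is cardioidal if every pair has the form $\{i,2i\bmod n\}$ for some $i\in\mathbb{Z}_n\setminus\{0\}$. *)

theory Defs
  imports "HOL-Number_Theory.Residues" "HOL-Library.Disjoint_Sets"
begin

text \<open>
  The ring of integers modulo \<open>n\<close>, with the integers \<open>0, \<dots>, n - 1\<close> as its elements.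
\<close>

abbreviation Zmod :: "nat \<Rightarrow> int ring" where
  "Zmod n \<equiv> residue_ring (int n)"

abbreviation nonzero :: "nat \<Rightarrow> int set" where
  "nonzero n \<equiv> carrier (Zmod n) - {\<zero>\<^bsub>Zmod n\<^esub>}"

text \<open>
  A starter is a set of unordered pairs. Since \<open>{s, t} = {t, s}\<close>, the set of all
  \<open>s \<ominus> t\<close> with \<open>{s, t} \<in> S\<close> contains both differences \<open>\<plusminus>(s - t)\<close> of every pair.
  There are \<open>(n - 1) / 2\<close> pairs, so if the \<open>n - 1\<close> signed differences cover the \<open>n - 1\<close>
  non-zero elements, each of these occurs exactly once. The same count applies to the
  signed sums in \<open>skew_starter\<close>.
\<close>

definition starter :: "nat \<Rightarrow> int set set \<Rightarrow> bool" where
  "starter n S \<longleftrightarrow>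
     odd n \<and>
     partition_on (nonzero n) S \<and>
     card S = (n - 1) div 2 \<and>
     (\<forall>P\<in>S. card P = 2) \<and>
     {s \<ominus>\<^bsub>Zmod n\<^esub> t | s t. {s, t} \<in> S} = nonzero n"

definition strong_starter :: "nat \<Rightarrow> int set set \<Rightarrow> bool" where
  "strong_starter n S \<longleftrightarrow>
     starter n S \<and>
     (\<forall>s t. {s, t} \<in> S \<longrightarrow> s \<oplus>\<^bsub>Zmod n\<^esub> t \<noteq> \<zero>\<^bsub>Zmod n\<^esub>) \<and>
     (\<forall>s t u v. {s, t} \<in> S \<longrightarrow> {u, v} \<in> S \<longrightarrow> {s, t} \<noteq> {u, v} \<longrightarrow>
        s \<oplus>\<^bsub>Zmod n\<^esub> t \<noteq> u \<oplus>\<^bsub>Zmod n\<^esub> v)"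

definition skew_starter :: "nat \<Rightarrow> int set set \<Rightarrow> bool" where
  "skew_starter n S \<longleftrightarrow>
     strong_starter n S \<and>
     {s \<oplus>\<^bsub>Zmod n\<^esub> t | s t. {s, t} \<in> S} \<union>
       {\<ominus>\<^bsub>Zmod n\<^esub> (s \<oplus>\<^bsub>Zmod n\<^esub> t) | s t. {s, t} \<in> S} = nonzero n"

definition cardioidal_starter :: "nat \<Rightarrow> int set set \<Rightarrow> bool" where
  "cardioidal_starter n S \<longleftrightarrow>
     starter n S \<and> (\<forall>P\<in>S. \<exists>i\<in>nonzero n. P = {i, (2 * i) mod int n})"

end

theory Submission
  imports Defs
begin

text \<open>
  The pair \<open>{i, 2i}\<close> has the signed differences \<open>\<plusminus>i\<close> and the sum \<open>3i\<close>. So the signed sums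
  are the signed differences multiplied by \<open>3\<close>, and multiplication by \<open>3\<close> permutes the
  non-zero elements because \<open>3\<close> is a unit. A pair is determined by \<open>i\<close>, hence by \<open>3i\<close>, so
  the sums are distinct.
\<close>

lemma nonzero_eq: "nonzero n = {0<..<int n}"
  by (auto simp: residue_ring_def)

lemma mod_in_nonzero_iff:
  assumes "n > 0"
  shows "a mod int n \<in> nonzero n \<longleftrightarrow> \<not> int n dvd a"
proof -
  have "0 \<le> a mod int n" "a mod int n < int n"
    using assms by simp_all
  then show ?thesis
    unfolding nonzero_eq dvd_eq_mod_eq_0 greaterThanLessThan_iff by linarith
qed

text \<open>Pairs are unordered, so \<open>s\<close> can be either \<open>i\<close> or its double.
  The sum is symmetric and comes out the same in both cases, while swapping \<open>s\<close> and
  \<open>t\<close> flips the sign of the difference; hence the disjunction.\<close>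

lemma cardioidal_starter_pairE:
  assumes "cardioidal_starter n S" "n \<ge> 3" "{s, t} \<in> S"
  obtains i where "i \<in> nonzero n" "{s, t} = {i, (2 * i) mod int n}"
    "s \<oplus>\<^bsub>Zmod n\<^esub> t = (3 * i) mod int n"
    "s \<ominus>\<^bsub>Zmod n\<^esub> t = i mod int n \<or> s \<ominus>\<^bsub>Zmod n\<^esub> t = (- i) mod int n"
proof -
  interpret residues "int n" "Zmod n"
    using assms(2) by unfold_locales auto
  obtain i where i: "i \<in> nonzero n" "{s, t} = {i, (2 * i) mod int n}"
    using assms unfolding cardioidal_starter_def by blast
  consider "s = i" "t = (2 * i) mod int n" | "s = (2 * i) mod int n" "t = i"
    using i(2) by (auto simp: doubleton_eq_iff)
  then have "s \<oplus>\<^bsub>Zmod n\<^esub> t = (3 * i) mod int n \<and>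
    (s \<ominus>\<^bsub>Zmod n\<^esub> t = i mod int n \<or> s \<ominus>\<^bsub>Zmod n\<^esub> t = (- i) mod int n)"
    by cases (simp_all add: a_minus_def res_add_eq res_neg_eq mod_simps)
  with i that show thesis by blast
qed

theorem theorem4:
  fixes n :: nat and S :: "int set set"
  assumes "n \<ge> 3" and "odd n" and "\<not> 3 dvd n"
    and "cardioidal_starter n S"
  shows "skew_starter n S"
proof -
  interpret residues "int n" "Zmod n"
    using assms(1) by unfold_locales auto
  note pairE = cardioidal_starter_pairE[OF assms(4,1)]
  have starter: "starter n S"
    using assms(4) by (simp add: cardioidal_starter_def)
  have "\<not> (3::int) dvd int n"
    using assms(3) by presburger
  then have cop: "coprime (3::int) (int n)"
    by (intro prime_imp_coprime) auto
  have dvd3: "int n dvd 3 * i \<longleftrightarrow> int n dvd i" for i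
    using cop by (simp add: coprime_commute coprime_dvd_mult_right_iff)
  have not_dvd: "\<not> int n dvd i" if "i \<in> nonzero n" for i
    using that zdvd_not_zless by (auto simp: nonzero_eq)
  have sum_nonzero: "s \<oplus>\<^bsub>Zmod n\<^esub> t \<in> nonzero n" if "{s, t} \<in> S" for s t
    using that assms(1) by (elim pairE) (simp only: mod_in_nonzero_iff dvd3 not_dvd not_False_eq_True)
  \<comment> \<open>Contrapositive of the distinctness clause in
    \<open>strong_starter\<close>.\<close>
  have "{s, t} = {u, v}"
    if st: "{s, t} \<in> S" and uv: "{u, v} \<in> S" and eq: "s \<oplus>\<^bsub>Zmod n\<^esub> t = u \<oplus>\<^bsub>Zmod n\<^esub> v" for s t u v
  proof -
    obtain i where i: "i \<in> nonzero n" "{s, t} = {i, (2 * i) mod int n}"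
      "s \<oplus>\<^bsub>Zmod n\<^esub> t = (3 * i) mod int n"
      using pairE[OF st] by metis
    obtain j where j: "j \<in> nonzero n" "{u, v} = {j, (2 * j) mod int n}"
      "u \<oplus>\<^bsub>Zmod n\<^esub> v = (3 * j) mod int n"
      using pairE[OF uv] by metis
    have "[3 * i = 3 * j] (mod int n)"
      using i(3) j(3) eq by (simp add: cong_def)
    then have "[i = j] (mod int n)"
      using cop cong_mult_lcancel by blast
    \<comment> \<open>Both lie strictly between 0 and \<open>n\<close>, where congruence modulo
      \<open>n\<close> is equality.\<close>
    then have "i = j"
      using i(1) j(1) by (intro cong_less_imp_eq_int) (auto simp: nonzero_eq)
    with i(2) j(2) show ?thesis by simp
  qed
  with starter sum_nonzero have strong: "strong_starter n S"
    unfolding strong_starter_def by blast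
  let ?sums = "{s \<oplus>\<^bsub>Zmod n\<^esub> t | s t. {s, t} \<in> S}"
  let ?neg_sums = "{\<ominus>\<^bsub>Zmod n\<^esub> (s \<oplus>\<^bsub>Zmod n\<^esub> t) | s t. {s, t} \<in> S}"
  have "\<ominus>\<^bsub>Zmod n\<^esub> (s \<oplus>\<^bsub>Zmod n\<^esub> t) \<in> nonzero n" if "{s, t} \<in> S" for s t
    using sum_nonzero[OF that] by simp
  with sum_nonzero have "?sums \<union> ?neg_sums \<subseteq> nonzero n"
    unfolding subset_iff Un_iff mem_Collect_eq by metis
  moreover have "y \<in> ?sums \<union> ?neg_sums" if y: "y \<in> nonzero n" for y
  proof -
    \<comment> \<open>\<open>c\<close> is an inverse of 3 modulo \<open>n\<close>, so
      \<open>x\<close> below is \<open>y\<close> divided by 3, reduced modulo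
      \<open>n\<close>.\<close>
    obtain c where c: "[3 * c = 1] (mod int n)"
      using cop cong_solve_coprime_int by blast
    define x where "x = (c * y) mod int n"
    have "[3 * c * y = 1 * y] (mod int n)"
      using c by (rule cong_scalar_right)
    then have "[3 * x = y] (mod int n)"
      by (simp add: x_def cong_def mod_simps mult.assoc)
    then have y_eq: "(3 * x) mod int n = y"
      using y by (simp add: cong_def nonzero_eq)
    \<comment> \<open>Otherwise \<open>n\<close> would divide \<open>3 * x\<close>, forcing
      \<open>y\<close> to be 0.\<close>
    have "\<not> int n dvd x"
      using y_eq y dvd3[of x] by (auto simp: nonzero_eq)
    then have "x mod int n \<in> nonzero n"
      using assms(1) by (subst mod_in_nonzero_iff) auto
    then have "x \<in> nonzero n"
      by (simp add: x_def)
    \<comment> \<open>The difference condition of a starter supplies a pair with difference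
      \<open>x\<close>; the sum of this pair will be \<open>y\<close> up to sign.\<close>
    then obtain s t where st: "{s, t} \<in> S" and x: "x = s \<ominus>\<^bsub>Zmod n\<^esub> t"
      using starter unfolding starter_def by blast
    obtain i where sum: "s \<oplus>\<^bsub>Zmod n\<^esub> t = (3 * i) mod int n"
      and "x = i mod int n \<or> x = (- i) mod int n"
      using pairE[OF st] x by metis
    \<comment> \<open>Since \<open>x\<close> is \<open>i\<close> up to sign, \<open>3 * x\<close> is
      the sum of the pair up to the same sign. The two cases land in \<open>?sums\<close> and
      \<open>?neg_sums\<close> respectively.\<close>
    then have "(3 * x) mod int n = (3 * i) mod int n \<or>
      (3 * x) mod int n = (- (3 * i)) mod int n"
      by (auto simp: mod_simps)
    then have "y = s \<oplus>\<^bsub>Zmod n\<^esub> t \<or> y = \<ominus>\<^bsub>Zmod n\<^esub> (s \<oplus>\<^bsub>Zmod n\<^esub> t)"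
      by (simp add: y_eq sum res_neg_eq mod_simps)
    with st show ?thesis by blast
  qed
  ultimately show ?thesis
    using strong unfolding skew_starter_def by blast
qed

end
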